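(* Let $\mathcal{H}$ be a separable Hilbert space, let $\{(\mathcal{W}_i,w_i)\}_{i\in I}$ be a fusion frame for $\mathcal{H}$ and let $\mathcal{V}$ be a closed subspace of $\mathcal{H}$. Assume that $P_{\mathcal{V}}$ commutes with $P_{\mathcal{W}_i}$ for each $i\in I$. Then $\{(\mathcal{W}_i\cap\mathcal{V},w_i)\}_{i\in I}$ is a $P_{\mathcal{V}}$-fusion frame for $\mathcal{H}$.
   Context: The index set $I$ is finite or countable. $P_{\mathcal{W}}$ denotes the orthogonal projection of $\mathcal{H}$ onto the closed subspace $\mathcal{W}$. For closed subspaces $\mathcal{W}_i$ of $\mathcal{H}$, positive weights $w_i$ and a bounded linear operator $K$ on $\mathcal{H}$, $\{(\mathcal{W}_i,w_i)\}_{i\in I}$ is a fusion frame for $\mathcal{H}$ if there are constants $0<A\le B<\infty$ with $A\|f\|^2\le\sum_{i\in I}w_i^2\|P_{\mathcal{W}_i}f\|^2\le B\|f\|^2$ for all $f\in\mathcal{H}$, and a $K$-fusion frame for $\mathcal{H}$ if there are $A,B>0$ with $A\|K^*f\|^2\le\sum_{i\in I}w_i^2\|P_{\mathcal{W}_i}f\|^2\le B\|f\|^2$ for all $f\in\mathcal{H}$. *)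

theory Defs
  imports "HOL-Analysis.Analysis"
begin

text \<open>
  The paper's Hilbert spaces may be real or complex, and the library has no complex inner product
  spaces. Both cases are treated at once, over a class of scalar fields with instances
  \<^typ>\<open>real\<close> and \<^typ>\<open>complex\<close>. The operation \<open>scnj\<close> is the conjugation. (By the theorem of
  Gelfand and Mazur, \<open>\<real>\<close> and \<open>\<complex>\<close> with their usual conjugations are, up to isomorphism, the only models.)
\<close>

class hilbert_scalar = real_normed_field +
  fixes scnj :: "'a \<Rightarrow> 'a"
  assumes scnj_add: "scnj (a + b) = scnj a + scnj b"
    and scnj_mult: "scnj (a * b) = scnj a * scnj b"
    and scnj_scnj: "scnj (scnj a) = a"
    and mult_scnj: "a * scnj a = (norm a)\<^sup>2 *\<^sub>R 1"

instantiation real :: hilbert_scalar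
begin
definition scnj_real :: "real \<Rightarrow> real" where "scnj_real a = a"
instance by standard (simp_all add: scnj_real_def power2_eq_square)
end

instantiation complex :: hilbert_scalar
begin
definition scnj_complex :: "complex \<Rightarrow> complex" where "scnj_complex = cnj"
instance by standard (simp_all add: scnj_complex_def complex_norm_square[symmetric] scaleR_conv_of_real)
end

text \<open>
  Completeness is that of the class \<^class>\<open>banach\<close>. The last two assumptions say that the norm and
  the real scalar multiplication of the type are the ones coming from the inner product and from
  \<open>smul\<close>; in particular \<open>ip\<close> is positive definite. It is linear in its first argument.
\<close>

locale hilbert_space = vector_space smul
  for smul :: "'k::hilbert_scalar \<Rightarrow> 'a::banach \<Rightarrow> 'a" +
  fixes ip :: "'a \<Rightarrow> 'a \<Rightarrow> 'k"
  assumes ip_add_left: "ip (x + y) z = ip x z + ip y z"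
    and ip_smul_left: "ip (smul a x) y = a * ip x y"
    and ip_commute: "ip x y = scnj (ip y x)"
    and ip_self: "ip x x = of_real ((norm x)\<^sup>2)"
    and smul_of_real: "smul (of_real r) x = r *\<^sub>R x"

lemma hilbert_space_real:
  "hilbert_space scaleR (inner :: 'a::{real_inner, banach} \<Rightarrow> 'a \<Rightarrow> real)"
  by unfold_locales
    (simp_all add: scnj_real_def inner_add_left inner_commute power2_norm_eq_inner algebra_simps)

lemma hilbert_space_complex: "hilbert_space (*) (\<lambda>x y :: complex. x * cnj y)"
  by unfold_locales
    (simp_all add: scnj_complex_def complex_norm_square[symmetric] scaleR_conv_of_real algebra_simps)

definition closed_subspace :: "('k::hilbert_scalar \<Rightarrow> 'a::banach \<Rightarrow> 'a) \<Rightarrow> 'a set \<Rightarrow> bool" where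
  "closed_subspace smul W \<longleftrightarrow> module.subspace smul W \<and> closed W"

definition bounded_operator ::
  "('k::hilbert_scalar \<Rightarrow> 'a::banach \<Rightarrow> 'a) \<Rightarrow> ('a \<Rightarrow> 'a) \<Rightarrow> bool" where
  "bounded_operator smul K \<longleftrightarrow>
     Vector_Spaces.linear smul smul K \<and> (\<exists>C. \<forall>x. norm (K x) \<le> C * norm x)"

text \<open>
  The description is proper when \<open>W\<close> is a closed subspace of a Hilbert space (projection theorem).
\<close>

definition orth_proj :: "('a::banach \<Rightarrow> 'a \<Rightarrow> 'k::hilbert_scalar) \<Rightarrow> 'a set \<Rightarrow> 'a \<Rightarrow> 'a" where
  "orth_proj ip W f = (THE p. p \<in> W \<and> (\<forall>y\<in>W. ip (f - p) y = 0))"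

text \<open>
  The description is proper when \<open>K\<close> is a bounded operator (Riesz representation). The library's
  constant \<^const>\<open>adjoint\<close> is restricted to real inner products.
\<close>

definition hilbert_adjoint ::
  "('a::banach \<Rightarrow> 'a \<Rightarrow> 'k::hilbert_scalar) \<Rightarrow> ('a \<Rightarrow> 'a) \<Rightarrow> 'a \<Rightarrow> 'a" where
  "hilbert_adjoint ip K = (THE L. \<forall>x y. ip (K x) y = ip x (L y))"

text \<open>
  Summability is stated separately because \<^const>\<open>infsum\<close> is \<open>0\<close> on families that are not summable;
  for these nonnegative terms it says exactly that the sum is finite.
\<close>

definition fusion_frame ::
  "('k::hilbert_scalar \<Rightarrow> 'a::banach \<Rightarrow> 'a) \<Rightarrow> ('a \<Rightarrow> 'a \<Rightarrow> 'k) \<Rightarrow>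
   'i set \<Rightarrow> ('i \<Rightarrow> 'a set) \<Rightarrow> ('i \<Rightarrow> real) \<Rightarrow> bool" where
  "fusion_frame smul ip I W w \<longleftrightarrow>
     (\<forall>i\<in>I. closed_subspace smul (W i) \<and> 0 < w i) \<and>
     (\<exists>A B. 0 < A \<and> A \<le> B \<and>
       (\<forall>f. (\<lambda>i. (w i)\<^sup>2 * (norm (orth_proj ip (W i) f))\<^sup>2) summable_on I \<and>
            A * (norm f)\<^sup>2 \<le> (\<Sum>\<^sub>\<infinity>i\<in>I. (w i)\<^sup>2 * (norm (orth_proj ip (W i) f))\<^sup>2) \<and>
            (\<Sum>\<^sub>\<infinity>i\<in>I. (w i)\<^sup>2 * (norm (orth_proj ip (W i) f))\<^sup>2) \<le> B * (norm f)\<^sup>2))"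

definition K_fusion_frame ::
  "('k::hilbert_scalar \<Rightarrow> 'a::banach \<Rightarrow> 'a) \<Rightarrow> ('a \<Rightarrow> 'a \<Rightarrow> 'k) \<Rightarrow> ('a \<Rightarrow> 'a) \<Rightarrow>
   'i set \<Rightarrow> ('i \<Rightarrow> 'a set) \<Rightarrow> ('i \<Rightarrow> real) \<Rightarrow> bool" where
  "K_fusion_frame smul ip K I W w \<longleftrightarrow>
     bounded_operator smul K \<and>
     (\<forall>i\<in>I. closed_subspace smul (W i) \<and> 0 < w i) \<and>
     (\<exists>A B. 0 < A \<and> 0 < B \<and>
       (\<forall>f. (\<lambda>i. (w i)\<^sup>2 * (norm (orth_proj ip (W i) f))\<^sup>2) summable_on I \<and>
            A * (norm (hilbert_adjoint ip K f))\<^sup>2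
              \<le> (\<Sum>\<^sub>\<infinity>i\<in>I. (w i)\<^sup>2 * (norm (orth_proj ip (W i) f))\<^sup>2) \<and>
            (\<Sum>\<^sub>\<infinity>i\<in>I. (w i)\<^sup>2 * (norm (orth_proj ip (W i) f))\<^sup>2) \<le> B * (norm f)\<^sup>2))"

end

theory Submission imports Defs begin

text \<open>
  If the projections onto \<open>V\<close> and \<open>W\<close> commute, then their product is the projection onto \<open>W \<inter> V\<close>.
  So the frame sum of the subspaces \<open>W i \<inter> V\<close> at \<open>f\<close> is that of the \<open>W i\<close> at the projection of \<open>f\<close>
  to \<open>V\<close>. As this projection is self-adjoint and does not increase norms, the frame bounds carry over.
\<close>

section \<open>Conjugation and inner product algebra\<close>

text \<open>For nonzero \<open>r\<close>, \<open>mult_scnj\<close> reads r * scnj r = r * r and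
  \<open>r\<close> cancels; at 0 additivity decides.\<close>

lemma scnj_of_real [simp]: "scnj (of_real r :: 'a::hilbert_scalar) = of_real r"
proof (cases "r = 0")
  case True
  have "scnj (0::'a) + scnj 0 = scnj 0"
    using scnj_add[of "0::'a" 0] by simp
  then show ?thesis using True by simp
next
  case False
  have "(of_real r :: 'a) * scnj (of_real r) = of_real r * of_real r"
    using mult_scnj[of "of_real r :: 'a"] by (simp add: of_real_def power2_eq_square)
  with False show ?thesis by simp
qed

lemma scnj_0 [simp]: "scnj (0 :: 'a::hilbert_scalar) = 0"
  using scnj_of_real[of 0] by simp

context hilbert_space
begin

lemma ip_0_left [simp]: "ip 0 y = 0"
  using ip_add_left[of 0 0 y] by simp

lemma ip_minus_left: "ip (- x) y = - ip x y"
  using ip_add_left[of x "- x" y] by (simp add: add_eq_0_iff)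

lemma ip_diff_left: "ip (x - y) z = ip x z - ip y z"
  using ip_add_left[of x "- y" z] by (simp add: ip_minus_left)

lemma ip_add_right: "ip z (x + y) = ip z x + ip z y"
  by (metis ip_add_left ip_commute scnj_add)

lemma ip_0_right [simp]: "ip x 0 = 0"
  using ip_add_right[of x 0 0] by simp

lemma ip_minus_right: "ip x (- y) = - ip x y"
  using ip_add_right[of x y "- y"] by (simp add: add_eq_0_iff)

lemma ip_diff_right: "ip z (x - y) = ip z x - ip z y"
  using ip_add_right[of z x "- y"] by (simp add: ip_minus_right)

lemma ip_smul_right: "ip x (smul a y) = scnj a * ip x y"
  by (metis ip_smul_left ip_commute scnj_mult)

lemma ip_eq_0_commute: "ip x y = 0 \<longleftrightarrow> ip y x = 0"
  by (metis ip_commute scnj_0)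

lemma ip_self_eq_0 [simp]: "ip x x = 0 \<longleftrightarrow> x = 0"
  by (simp add: ip_self)

lemma parallelogram_law:
  fixes x y :: 'a
  shows "(norm (x + y))\<^sup>2 + (norm (x - y))\<^sup>2 = 2 * (norm x)\<^sup>2 + 2 * (norm y)\<^sup>2"
proof -
  have "ip (x + y) (x + y) + ip (x - y) (x - y) = 2 * ip x x + 2 * ip y y"
    by (simp add: ip_add_left ip_add_right ip_diff_left ip_diff_right)
  \<comment> \<open>The identity holds in the scalar field; injectivity of \<open>of_real\<close>
    brings it back to the real norms.\<close>
  then have "(of_real ((norm (x + y))\<^sup>2 + (norm (x - y))\<^sup>2) :: 'k)
      = of_real (2 * (norm x)\<^sup>2 + 2 * (norm y)\<^sup>2)"
    by (simp add: ip_self)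
  then show ?thesis unfolding of_real_eq_iff .
qed

lemma pythagoras:
  assumes "ip x y = 0"
  shows "(norm (x + y))\<^sup>2 = (norm x)\<^sup>2 + (norm y)\<^sup>2"
proof -
  have "ip (x + y) (x + y) = ip x x + ip y y"
    using assms ip_eq_0_commute[of x y] by (simp add: ip_add_left ip_add_right)
  then have "(of_real ((norm (x + y))\<^sup>2) :: 'k) = of_real ((norm x)\<^sup>2 + (norm y)\<^sup>2)"
    by (simp add: ip_self)
  then show ?thesis unfolding of_real_eq_iff .
qed

section \<open>Projection theorem\<close>

text \<open>A minimizing sequence for the distance from \<open>f\<close> to \<open>W\<close> is
  Cauchy; completeness gives a limit, which lies in \<open>W\<close> because \<open>W\<close> is
  closed.\<close>

lemma closest_point_exists:
  assumes "closed_subspace smul W"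
  obtains p where "p \<in> W" "\<And>y. y \<in> W \<Longrightarrow> norm (f - p) \<le> norm (f - y)"
proof -
  have sub: "subspace W" and cl: "closed W"
    using assms by (auto simp: closed_subspace_def)
  define D where "D = (INF y\<in>W. (norm (f - y))\<^sup>2)"
  have ne: "W \<noteq> {}"
    using subspace_0[OF sub] by blast
  have bdd: "bdd_below ((\<lambda>y. (norm (f - y))\<^sup>2) ` W)"
    by (rule bdd_belowI[of _ 0]) auto
  have D_le: "D \<le> (norm (f - y))\<^sup>2" if "y \<in> W" for y
    unfolding D_def by (rule cINF_lower[OF bdd that])
  have "\<exists>y\<in>W. (norm (f - y))\<^sup>2 < D + inverse (real (Suc n))" for n
    using cINF_less_iff[OF ne bdd, of "D + inverse (real (Suc n))"] by (simp add: D_def)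
  then obtain y where yW: "\<And>n. y n \<in> W"
    and yD: "\<And>n. (norm (f - y n))\<^sup>2 < D + inverse (real (Suc n))"
    by metis
  \<comment> \<open>The midpoint of two nearly closest points lies in \<open>W\<close>, so the parallelogram law keeps them close.\<close>
  have near: "(norm (y m - y n))\<^sup>2 \<le> 2 * inverse (real (Suc m)) + 2 * inverse (real (Suc n))"
    for m n
  proof -
    define z where "z = (1/2) *\<^sub>R (y m + y n)"
    have "z \<in> W"
      unfolding z_def smul_of_real[symmetric]
      by (intro subspace_scale[OF sub] subspace_add[OF sub] yW)
    moreover have "2 *\<^sub>R z = y m + y n"
      by (simp add: z_def)
    then have "(f - y m) + (f - y n) = 2 *\<^sub>R (f - z)"
      by (simp add: scaleR_right_diff_distrib) (simp add: scaleR_2)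
    then have "(norm ((f - y m) + (f - y n)))\<^sup>2 = 4 * (norm (f - z))\<^sup>2"
      by (simp add: power_mult_distrib)
    moreover have "(norm ((f - y m) - (f - y n)))\<^sup>2 = (norm (y m - y n))\<^sup>2"
      by (simp add: norm_minus_commute)
    \<comment> \<open>The bound 4 * D for the midpoint term cancels the 4 * D from the two upper
      bounds, so only the slacks remain.\<close>
    ultimately show ?thesis
      using parallelogram_law[of "f - y m" "f - y n"] D_le[of z] yD[of m] yD[of n] by linarith
  qed
  have "Cauchy y"
  proof (rule metric_CauchyI)
    fix e :: real
    assume "0 < e"
    \<comment> \<open>Each of the two slacks enters \<open>near\<close> with factor 2, hence the
      quarter of the square of \<open>e\<close>.\<close>
    then obtain N where N: "inverse (real (Suc N)) < e\<^sup>2 / 4"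
      using reals_Archimedean[of "e\<^sup>2 / 4"] by auto
    have "dist (y m) (y n) < e" if "m \<ge> N" "n \<ge> N" for m n
    proof -
      have "inverse (real (Suc m)) \<le> inverse (real (Suc N))"
           "inverse (real (Suc n)) \<le> inverse (real (Suc N))"
        using that by (auto intro!: le_imp_inverse_le)
      then have "(norm (y m - y n))\<^sup>2 < e\<^sup>2"
        using near[of m n] N by linarith
      then show ?thesis
        using \<open>0 < e\<close> by (simp add: dist_norm power2_less_imp_less)
    qed
    then show "\<exists>M. \<forall>m\<ge>M. \<forall>n\<ge>M. dist (y m) (y n) < e" by blast
  qed
  then obtain p where p: "y \<longlonglongrightarrow> p"
    using Cauchy_convergent convergent_def by blast
  have pW: "p \<in> W"
    using closed_sequentially[OF cl _ p] yW by blast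
  have "(\<lambda>n. (norm (f - y n))\<^sup>2) \<longlonglongrightarrow> (norm (f - p))\<^sup>2"
    by (intro tendsto_intros p)
  moreover have "(\<lambda>n. D + inverse (real (Suc n))) \<longlonglongrightarrow> D + 0"
    by (rule tendsto_add[OF tendsto_const LIMSEQ_inverse_real_of_nat])
  \<comment> \<open>The strict bounds \<open>yD\<close> become a weak bound in the limit.\<close>
  ultimately have le: "(norm (f - p))\<^sup>2 \<le> D + 0"
    by (rule LIMSEQ_le) (blast intro: less_imp_le[OF yD])
  have "norm (f - p) \<le> norm (f - z)" if "z \<in> W" for z
  proof (rule power2_le_imp_le)
    show "(norm (f - p))\<^sup>2 \<le> (norm (f - z))\<^sup>2"
      using le D_le[OF that] by linarith
  qed simp
  with pW that show ?thesis by blast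
qed

text \<open>If \<open>f - p\<close> had a component along \<open>y\<close>, adding that component to
  \<open>p\<close> would give a point of \<open>W\<close> strictly closer to
  \<open>f\<close>.\<close>

lemma closest_point_orthogonal:
  assumes "closed_subspace smul W" "p \<in> W" "y \<in> W"
    and min: "\<And>z. z \<in> W \<Longrightarrow> norm (f - p) \<le> norm (f - z)"
  shows "ip (f - p) y = 0"
proof (cases "y = 0")
  case False
  have sub: "subspace W"
    using assms(1) by (simp add: closed_subspace_def)
  \<comment> \<open>The coefficient of \<open>f - p\<close> along \<open>y\<close>, chosen to make
    the remainder \<open>u\<close> orthogonal to \<open>y\<close>.\<close>
  define a where "a = ip (f - p) y / ip y y"
  define u where "u = f - p - smul a y"
  have "p + smul a y \<in> W"
    by (intro subspace_add[OF sub] subspace_scale[OF sub] assms(2,3))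
  from min[OF this] have le: "norm (f - p) \<le> norm u"
    by (simp add: u_def algebra_simps)
  have "ip u y = 0"
    using False by (simp add: u_def ip_diff_left[of _ "smul a y"] ip_smul_left) (simp add: a_def)
  then have "ip u (smul a y) = 0"
    by (simp add: ip_smul_right)
  from pythagoras[OF this] have "(norm (f - p))\<^sup>2 = (norm u)\<^sup>2 + (norm (smul a y))\<^sup>2"
    by (simp add: u_def)
  moreover have "(norm (f - p))\<^sup>2 \<le> (norm u)\<^sup>2"
    using le by (simp add: power_mono)
  ultimately have "(norm (smul a y))\<^sup>2 \<le> 0" by linarith
  then have "smul a y = 0" by simp
  then show ?thesis
    using False by (simp add: a_def)
qed simp

section \<open>Orthogonal projections\<close>

lemma orth_proj_eqI:
  assumes "closed_subspace smul W" "p \<in> W" "\<And>y. y \<in> W \<Longrightarrow> ip (f - p) y = 0"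
  shows "orth_proj ip W f = p"
  unfolding orth_proj_def
proof (rule the_equality)
  fix q
  assume q: "q \<in> W \<and> (\<forall>y\<in>W. ip (f - q) y = 0)"
  have "q - p \<in> W"
    using assms(1,2) q by (auto simp: closed_subspace_def intro: subspace_diff)
  \<comment> \<open>The difference of two candidates lies in \<open>W\<close>; subtracting the two
    orthogonality relations shows it is orthogonal to itself.\<close>
  then have "ip (f - p) (q - p) - ip (f - q) (q - p) = 0"
    using assms(3) q by simp
  then have "ip (q - p) (q - p) = 0"
    by (simp flip: ip_diff_left)
  then show "q = p" by simp
qed (use assms in blast)

text \<open>A closest point meets the description in \<open>orth_proj\<close>, which therefore
  denotes it; later proofs rely only on these two properties and uniqueness.\<close>

lemma
  assumes "closed_subspace smul W"
  shows orth_proj_in: "orth_proj ip W f \<in> W"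
    and orth_proj_orthogonal: "y \<in> W \<Longrightarrow> ip (f - orth_proj ip W f) y = 0"
proof -
  obtain p where p: "p \<in> W" "\<And>z. z \<in> W \<Longrightarrow> norm (f - p) \<le> norm (f - z)"
    using closest_point_exists[OF assms, of f] by blast
  note orth = closest_point_orthogonal[OF assms p(1) _ p(2)]
  have "orth_proj ip W f = p"
    using assms p(1) orth by (rule orth_proj_eqI)
  then show "orth_proj ip W f \<in> W" "y \<in> W \<Longrightarrow> ip (f - orth_proj ip W f) y = 0"
    using p(1) orth by auto
qed

lemma orth_proj_id:
  assumes "closed_subspace smul W" "x \<in> W"
  shows "orth_proj ip W x = x"
  by (rule orth_proj_eqI) (use assms in auto)

text \<open>Both sides equal the inner product of the two projections, as the residuals are
  orthogonal to \<open>W\<close>.\<close>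

lemma orth_proj_self_adjoint:
  assumes "closed_subspace smul W"
  shows "ip (orth_proj ip W x) y = ip x (orth_proj ip W y)"
proof -
  have "ip (orth_proj ip W x) (y - orth_proj ip W y) = 0"
    using orth_proj_orthogonal[OF assms orth_proj_in[OF assms]] ip_eq_0_commute by blast
  moreover have "ip (x - orth_proj ip W x) (orth_proj ip W y) = 0"
    by (rule orth_proj_orthogonal[OF assms orth_proj_in[OF assms]])
  ultimately show ?thesis
    by (simp add: ip_diff_left ip_diff_right)
qed

lemma norm_orth_proj_le:
  assumes "closed_subspace smul W"
  shows "norm (orth_proj ip W f) \<le> norm f"
proof -
  have "ip (f - orth_proj ip W f) (orth_proj ip W f) = 0"
    by (rule orth_proj_orthogonal[OF assms orth_proj_in[OF assms]])
  from pythagoras[OF this] have "(norm (orth_proj ip W f))\<^sup>2 \<le> (norm f)\<^sup>2"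
    by simp
  then show ?thesis
    by (rule power2_le_imp_le) simp
qed

text \<open>Linearity follows from uniqueness: sums and multiples of projections satisfy the
  characterization for the sums and multiples of the vectors.\<close>

lemma bounded_operator_orth_proj:
  assumes "closed_subspace smul W"
  shows "bounded_operator smul (orth_proj ip W)"
proof -
  have sub: "subspace W"
    using assms by (simp add: closed_subspace_def)
  have "orth_proj ip W (x + y) = orth_proj ip W x + orth_proj ip W y" for x y
  proof (rule orth_proj_eqI[OF assms])
    show "orth_proj ip W x + orth_proj ip W y \<in> W"
      by (intro subspace_add[OF sub] orth_proj_in[OF assms])
    show "ip (x + y - (orth_proj ip W x + orth_proj ip W y)) z = 0" if "z \<in> W" for z
      using orth_proj_orthogonal[OF assms that, of x] orth_proj_orthogonal[OF assms that, of y]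
      by (simp add: ip_add_left ip_diff_left)
  qed
  moreover have "orth_proj ip W (smul c x) = smul c (orth_proj ip W x)" for c x
  proof (rule orth_proj_eqI[OF assms])
    show "smul c (orth_proj ip W x) \<in> W"
      by (intro subspace_scale[OF sub] orth_proj_in[OF assms])
    show "ip (smul c x - smul c (orth_proj ip W x)) z = 0" if "z \<in> W" for z
      using orth_proj_orthogonal[OF assms that, of x]
      by (simp add: ip_smul_left flip: scale_right_diff_distrib)
  qed
  ultimately have "Vector_Spaces.linear smul smul (orth_proj ip W)"
    unfolding Vector_Spaces.linear_iff using vector_space_axioms by blast
  moreover have "\<forall>x. norm (orth_proj ip W x) \<le> 1 * norm x"
    using norm_orth_proj_le[OF assms] by simp
  ultimately show ?thesis
    unfolding bounded_operator_def by blast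
qed

section \<open>Adjoints and projections onto intersections\<close>

text \<open>Two candidates differ at each point by a vector orthogonal to everything, in particular
  to itself.\<close>

lemma hilbert_adjoint_eqI:
  assumes "\<And>x y. ip (K x) y = ip x (L y)"
  shows "hilbert_adjoint ip K = L"
  unfolding hilbert_adjoint_def
proof (rule the_equality)
  fix M
  assume M: "\<forall>x y. ip (K x) y = ip x (M y)"
  have "ip (M y - L y) (M y - L y) = 0" for y
    using M assms by (metis ip_diff_right diff_self)
  then show "M = L" by (auto simp: fun_eq_iff)
qed (use assms in blast)

lemma closed_subspace_Int:
  assumes "closed_subspace smul U" "closed_subspace smul W"
  shows "closed_subspace smul (U \<inter> W)"
  using assms by (auto simp: closed_subspace_def intro: subspace_inter)

lemma orth_proj_Int:
  assumes W: "closed_subspace smul W" and V: "closed_subspace smul V"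
    and comm: "orth_proj ip V \<circ> orth_proj ip W = orth_proj ip W \<circ> orth_proj ip V"
  shows "orth_proj ip (W \<inter> V) f = orth_proj ip W (orth_proj ip V f)"
proof (rule orth_proj_eqI[OF closed_subspace_Int[OF W V]])
  have "orth_proj ip V (orth_proj ip W f) = orth_proj ip W (orth_proj ip V f)"
    using fun_cong[OF comm] by simp
  \<comment> \<open>By commutation the point is a value of both projections.\<close>
  then show "orth_proj ip W (orth_proj ip V f) \<in> W \<inter> V"
    by (metis IntI orth_proj_in W V)
  \<comment> \<open>Self-adjointness moves both projections onto \<open>y\<close>, which each of
    them fixes.\<close>
  show "ip (f - orth_proj ip W (orth_proj ip V f)) y = 0" if "y \<in> W \<inter> V" for y
    using that
    by (simp add: ip_diff_left orth_proj_self_adjoint[OF W] orth_proj_self_adjoint[OF V]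
        orth_proj_id[OF W] orth_proj_id[OF V])
qed

end

theorem theorem4p12:
  fixes smul :: "'k::hilbert_scalar \<Rightarrow> 'a::banach \<Rightarrow> 'a"
    and ip :: "'a \<Rightarrow> 'a \<Rightarrow> 'k"
    and I :: "'i set"
    and W :: "'i \<Rightarrow> 'a set"
    and w :: "'i \<Rightarrow> real"
    and V :: "'a set"
  assumes "hilbert_space smul ip"
    and "separable_space (euclidean :: 'a topology)"
    and "countable I"
    and "fusion_frame smul ip I W w"
    and "closed_subspace smul V"
    and "\<And>i. i \<in> I \<Longrightarrow>
           orth_proj ip V \<circ> orth_proj ip (W i) = orth_proj ip (W i) \<circ> orth_proj ip V"
  shows "K_fusion_frame smul ip (orth_proj ip V) I (\<lambda>i. W i \<inter> V) w"
proof -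
  interpret hilbert_space smul ip by fact
  note V = assms(5)
  let ?P = "orth_proj ip V"
  let ?S = "\<lambda>W f i. (w i)\<^sup>2 * (norm (orth_proj ip (W i) f))\<^sup>2"
  have W: "closed_subspace smul (W i)" "0 < w i" if "i \<in> I" for i
    using assms(4) that by (auto simp: fusion_frame_def)
  obtain A B where AB: "0 < A" "A \<le> B"
    and frame: "\<And>f. ?S W f summable_on I" "\<And>f. A * (norm f)\<^sup>2 \<le> infsum (?S W f) I"
      "\<And>f. infsum (?S W f) I \<le> B * (norm f)\<^sup>2"
    using assms(4) unfolding fusion_frame_def by blast
  have eq: "?S (\<lambda>i. W i \<inter> V) f i = ?S W (?P f) i" if "i \<in> I" for f i
    using orth_proj_Int[OF W(1)[OF that] V assms(6)[OF that]] by simp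
  have adj: "hilbert_adjoint ip ?P = ?P"
    by (rule hilbert_adjoint_eqI) (rule orth_proj_self_adjoint[OF V])
  have sum_eq: "infsum (?S (\<lambda>i. W i \<inter> V) f) I = infsum (?S W (?P f)) I" for f
    by (rule infsum_cong) (rule eq)
  have "?S (\<lambda>i. W i \<inter> V) f summable_on I" for f
    by (rule summable_on_cong[THEN iffD2, OF eq frame(1)])
  \<comment> \<open>The lower frame bound at \<open>?P f\<close>, with the same \<open>A\<close>,
    since \<open>?P\<close> is its own adjoint.\<close>
  moreover have "A * (norm (hilbert_adjoint ip ?P f))\<^sup>2 \<le> infsum (?S (\<lambda>i. W i \<inter> V) f) I" for f
    using frame(2)[of "?P f"] by (simp only: adj sum_eq)
  moreover have "infsum (?S (\<lambda>i. W i \<inter> V) f) I \<le> B * (norm f)\<^sup>2" for f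
  proof -
    \<comment> \<open>The upper frame bound at \<open>?P f\<close> is in terms of the norm of
      \<open>?P f\<close>, which is at most that of \<open>f\<close>, so \<open>B\<close> is kept
      too.\<close>
    have "B * (norm (?P f))\<^sup>2 \<le> B * (norm f)\<^sup>2"
      using AB norm_orth_proj_le[OF V] by (intro mult_left_mono power_mono) auto
    then show ?thesis
      using frame(3)[of "?P f"] by (simp only: sum_eq)
  qed
  moreover have "\<forall>i\<in>I. closed_subspace smul (W i \<inter> V) \<and> 0 < w i"
    using W closed_subspace_Int V by blast
  moreover have "0 < B" using AB by simp
  ultimately show ?thesis
    unfolding K_fusion_frame_def using bounded_operator_orth_proj[OF V] AB(1) by blast
qed

end
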